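(* Let $(G,\mathcal B)$ be a Rota-Baxter group of weight $-1$, let $\widetilde{\mathcal B}(a)=a\mathcal B(a^{-1})$ for $a\in G$, and let $(G_+,G_-,\rho,\mu)$ be the matched pair of groups on $(G,\mathcal B)$, with bicrossed product $G_+\bowtie G_-$. Then the operators $\mathcal C,\widetilde{\mathcal C}:G_+\bowtie G_-\to G_+\bowtie G_-$ defined, for all $a,b\in G$, by $$\mathcal C\big((\mathcal B(a),\widetilde{\mathcal B}(b))\big)=\Big(\mathcal B\big(\mathcal B(a)^{-1}\widetilde{\mathcal B}(b)^{-1}\big)^{-1},\ \widetilde{\mathcal B}\big(\widetilde{\mathcal B}(b)\mathcal B(a)\big)\Big),$$ $$\widetilde{\mathcal C}\big((\mathcal B(a),\widetilde{\mathcal B}(b))\big)=\Big(\mathcal B\big(\widetilde{\mathcal B}(b)\widetilde{\mathcal B}(a^{-1})\big)^{-1},\ \widetilde{\mathcal B}\big(\mathcal B(a)^{-1}\mathcal B(b^{-1})^{-1}\big)\Big)$$ are (well defined) group projections on $(G_+,G_-,\rho,\mu)$ such that, in $G_+\bowtie G_-$, $$\mathcal C\big((\mathcal B(a),\widetilde{\mathcal B}(b))\big)\,\widetilde{\mathcal C}\big((\mathcal B(a),\widetilde{\mathcal B}(b))\big)=(\mathcal B(a),\widetilde{\mathcal B}(b)),\qquad\forall a,b\in G.$$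
   Context: For a group $G$ and $a,b\in G$, $\mathrm{Ad}_a(b)=aba^{-1}$. A Rota-Baxter operator of weight $-1$ on a group $G$ is a map $\mathcal B:G\to G$ with $\mathcal B(a)\mathcal B(b)=\mathcal B((\mathrm{Ad}_{\mathcal B(a)}(b))a)$ for all $a,b\in G$; $(G,\mathcal B)$ is then a Rota-Baxter group of weight $-1$. The matched pair of groups on $(G,\mathcal B)$ is $(G_+,G_-,\rho,\mu)$ where $G_+=\mathrm{Im}\,\mathcal B$, $G_-=\mathrm{Im}\,\widetilde{\mathcal B}$ (subgroups of $G$), with the well-defined actions $\rho(\mathcal B(a))(\widetilde{\mathcal B}(b))=\widetilde{\mathcal B}(\mathrm{Ad}_{\mathcal B(a)}(b))$ of $G_+$ on the set $G_-$ and $\mu(\widetilde{\mathcal B}(a))(\mathcal B(b))=\mathcal B(\mathrm{Ad}_{\widetilde{\mathcal B}(a)}(b))$ of $G_-$ on the set $G_+$. The bicrossed product $G_+\bowtie G_-$ is the set $G_+\times G_-$ with the group multiplication $$(a_1,b_1)(a_2,b_2)=\big((\mu(b_2^{-1})a_1^{-1})^{-1}a_2,\ b_1(\rho(a_1)b_2)\big).$$ A group projection on a matched pair of groups $(G_+,G_-,\rho,\mu)$ is an idempotent group homomorphism $\mathcal C:G_+\bowtie G_-\to G_+\bowtie G_-$ such that the map $z\mapsto z\,\mathcal C(z^{-1})$ is also an idempotent group homomorphism of $G_+\bowtie G_-$. *)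

theory Defs
  imports "HOL-Algebra.Coset"
begin

definition Ad :: "('a, 'm) monoid_scheme \<Rightarrow> 'a \<Rightarrow> 'a \<Rightarrow> 'a" where
  "Ad G a b = a \<otimes>\<^bsub>G\<^esub> b \<otimes>\<^bsub>G\<^esub> inv\<^bsub>G\<^esub> a"

locale rota_baxter_group = group G for G (structure) +
  fixes B :: "'a \<Rightarrow> 'a"
  assumes B_closed: "B \<in> carrier G \<rightarrow> carrier G"
    and B_mult: "\<lbrakk>a \<in> carrier G; b \<in> carrier G\<rbrakk> \<Longrightarrow> B a \<otimes> B b = B (Ad G (B a) b \<otimes> a)"

definition rb_tilde :: "('a, 'm) monoid_scheme \<Rightarrow> ('a \<Rightarrow> 'a) \<Rightarrow> 'a \<Rightarrow> 'a" where
  "rb_tilde G B a = a \<otimes>\<^bsub>G\<^esub> B (inv\<^bsub>G\<^esub> a)"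

definition rb_plus :: "('a, 'm) monoid_scheme \<Rightarrow> ('a \<Rightarrow> 'a) \<Rightarrow> ('a, 'm) monoid_scheme" where
  "rb_plus G B = G\<lparr>carrier := B ` carrier G\<rparr>"

definition rb_minus :: "('a, 'm) monoid_scheme \<Rightarrow> ('a \<Rightarrow> 'a) \<Rightarrow> ('a, 'm) monoid_scheme" where
  "rb_minus G B = G\<lparr>carrier := rb_tilde G B ` carrier G\<rparr>"

text \<open>
  The values of the two actions do not depend on the chosen preimages; see the lemmas
  \<open>rb_rho_eq\<close> and \<open>rb_mu_eq\<close> below.  Off the product of the two images the values are
  unspecified.
\<close>

definition rb_rho :: "('a, 'm) monoid_scheme \<Rightarrow> ('a \<Rightarrow> 'a) \<Rightarrow> 'a \<Rightarrow> 'a \<Rightarrow> 'a" where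
  "rb_rho G B u v = (THE w. \<exists>a\<in>carrier G. \<exists>b\<in>carrier G.
     u = B a \<and> v = rb_tilde G B b \<and> w = rb_tilde G B (Ad G (B a) b))"

definition rb_mu :: "('a, 'm) monoid_scheme \<Rightarrow> ('a \<Rightarrow> 'a) \<Rightarrow> 'a \<Rightarrow> 'a \<Rightarrow> 'a" where
  "rb_mu G B v u = (THE w. \<exists>a\<in>carrier G. \<exists>b\<in>carrier G.
     v = rb_tilde G B a \<and> u = B b \<and> w = B (Ad G (rb_tilde G B a) b))"

definition bicrossed ::
  "('a, 'm) monoid_scheme \<Rightarrow> ('b, 'n) monoid_scheme \<Rightarrow> ('a \<Rightarrow> 'b \<Rightarrow> 'b) \<Rightarrow> ('b \<Rightarrow> 'a \<Rightarrow> 'a)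
    \<Rightarrow> ('a \<times> 'b) monoid" where
  "bicrossed P M \<rho> \<mu> =
     \<lparr>carrier = carrier P \<times> carrier M,
      mult = (\<lambda>(a1, b1) (a2, b2).
        (inv\<^bsub>P\<^esub> (\<mu> (inv\<^bsub>M\<^esub> b2) (inv\<^bsub>P\<^esub> a1)) \<otimes>\<^bsub>P\<^esub> a2, b1 \<otimes>\<^bsub>M\<^esub> \<rho> a1 b2)),
      one = (\<one>\<^bsub>P\<^esub>, \<one>\<^bsub>M\<^esub>)\<rparr>"

definition idempotent_hom :: "('a, 'm) monoid_scheme \<Rightarrow> ('a \<Rightarrow> 'a) \<Rightarrow> bool" where
  "idempotent_hom H C \<longleftrightarrow> C \<in> hom H H \<and> (\<forall>z\<in>carrier H. C (C z) = C z)"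

definition group_projection ::
  "('a, 'm) monoid_scheme \<Rightarrow> ('b, 'n) monoid_scheme \<Rightarrow> ('a \<Rightarrow> 'b \<Rightarrow> 'b) \<Rightarrow> ('b \<Rightarrow> 'a \<Rightarrow> 'a)
    \<Rightarrow> ('a \<times> 'b \<Rightarrow> 'a \<times> 'b) \<Rightarrow> bool" where
  "group_projection P M \<rho> \<mu> C \<longleftrightarrow>
     (let H = bicrossed P M \<rho> \<mu> in
      idempotent_hom H C \<and> idempotent_hom H (\<lambda>z. z \<otimes>\<^bsub>H\<^esub> C (inv\<^bsub>H\<^esub> z)))"

abbreviation rb_bicrossed :: "('a, 'm) monoid_scheme \<Rightarrow> ('a \<Rightarrow> 'a) \<Rightarrow> ('a \<times> 'a) monoid" where
  "rb_bicrossed G B \<equiv> bicrossed (rb_plus G B) (rb_minus G B) (rb_rho G B) (rb_mu G B)"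

context group
begin

lemma inv_cancel_left [simp]:
  "\<lbrakk>x \<in> carrier G; y \<in> carrier G\<rbrakk> \<Longrightarrow> inv x \<otimes> (x \<otimes> y) = y"
  "\<lbrakk>x \<in> carrier G; y \<in> carrier G\<rbrakk> \<Longrightarrow> x \<otimes> (inv x \<otimes> y) = y"
  by (simp_all flip: m_assoc)

end

context rota_baxter_group
begin

abbreviation T where "T \<equiv> rb_tilde G B"

lemma B_in [simp]: "a \<in> carrier G \<Longrightarrow> B a \<in> carrier G"
  using B_closed by auto

lemma T_in [simp]: "a \<in> carrier G \<Longrightarrow> T a \<in> carrier G"
  by (simp add: rb_tilde_def)

lemma Ad_in [simp]: "\<lbrakk>a \<in> carrier G; b \<in> carrier G\<rbrakk> \<Longrightarrow> Ad G a b \<in> carrier G"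
  by (simp add: Ad_def)

lemma B_mult': "\<lbrakk>a \<in> carrier G; b \<in> carrier G\<rbrakk> \<Longrightarrow> B a \<otimes> B b = B (B a \<otimes> (b \<otimes> (inv (B a) \<otimes> a)))"
  using B_mult[of a b] by (simp add: Ad_def m_assoc)

lemma B_one [simp]: "B \<one> = \<one>"
proof -
  have "B \<one> \<otimes> B \<one> = B \<one>" using B_mult'[of \<one> \<one>] by simp
  then show ?thesis by (metis B_in one_closed r_cancel_one)
qed

lemma T_one [simp]: "T \<one> = \<one>"
  by (simp add: rb_tilde_def)

lemma T_rb: "rota_baxter_group G T"
proof (unfold_locales, goal_cases)
  case 1 then show ?case by auto
next
  case (2 a b)
  let ?x = "a \<otimes> (B (inv a) \<otimes> (b \<otimes> inv (B (inv a))))"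
  have x: "Ad G (T a) b \<otimes> a = ?x"
    using 2 by (simp add: Ad_def rb_tilde_def inv_mult_group m_assoc)
  have "B (inv a) \<otimes> B (inv b) = B (inv ?x)"
    using 2 B_mult'[of "inv a" "inv b"] by (simp add: inv_mult_group m_assoc)
  then have "T ?x = ?x \<otimes> (B (inv a) \<otimes> B (inv b))" by (simp add: rb_tilde_def)
  also have "\<dots> = T a \<otimes> T b" using 2 by (simp add: rb_tilde_def m_assoc)
  finally show ?case using x by simp
qed

lemma T_T: "a \<in> carrier G \<Longrightarrow> rb_tilde G T a = B a"
  by (simp add: rb_tilde_def)

lemma B_inv: "a \<in> carrier G \<Longrightarrow> inv (B a) = B (inv (B a) \<otimes> inv a \<otimes> B a)"
  using B_mult'[of a "inv (B a) \<otimes> inv a \<otimes> B a"]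
  by (intro inv_equality[OF inv_comm]) (auto simp add: m_assoc)

lemma subgroup_B: "subgroup (B ` carrier G) G"
proof (unfold_locales, goal_cases)
  case 1 then show ?case by auto
next
  case (2 x y)
  then obtain a b where "a \<in> carrier G" "b \<in> carrier G" "x = B a" "y = B b" by auto
  then show ?case using B_mult[of a b] by auto
next
  case 3 then show ?case using B_one by (metis image_eqI one_closed)
next
  case (4 x)
  then obtain a where "a \<in> carrier G" "x = B a" by auto
  then show ?case using B_inv[of a] by auto
qed

text \<open>The fixed points \<open>l = B l\<close> are the inverses of the elements of the kernel of \<open>T\<close>.\<close>

lemma fixed_Ad:
  assumes "a \<in> carrier G" "l \<in> carrier G" "B l = l"
  shows "B (Ad G (B a) l) = Ad G (B a) l"
proof -
  let ?u = "B a"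
  let ?d = "inv ?u \<otimes> inv a \<otimes> ?u"
  let ?c = "?u \<otimes> (l \<otimes> (inv ?u \<otimes> a))"
  have c: "B ?c = ?u \<otimes> l" using B_mult'[of a l] assms by simp
  have "B ?c \<otimes> B ?d = B (Ad G (B ?c) ?d \<otimes> ?c)"
    using assms by (intro B_mult) auto
  also have "Ad G (B ?c) ?d \<otimes> ?c = Ad G ?u l"
    using assms c by (simp add: Ad_def m_assoc inv_mult_group)
  also have "B ?c \<otimes> B ?d = Ad G ?u l"
    using c assms B_inv[of a] by (simp add: Ad_def)
  finally show ?thesis by simp
qed

lemma T_Ad_cong:
  assumes "a \<in> carrier G" "b \<in> carrier G" "b' \<in> carrier G" "T b = T b'"
  shows "T (Ad G (B a) b) = T (Ad G (B a) b')"
proof -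
  interpret t: rota_baxter_group G T by (rule T_rb)
  define k where "k = inv b \<otimes> b'"
  have k[simp]: "k \<in> carrier G" and b': "b' = b \<otimes> k" using assms by (auto simp: k_def m_assoc)
  have B1: "B (inv b) = inv b \<otimes> T b"
    using assms(2) by (auto simp: rb_tilde_def)
  have B2: "B (inv b') = inv b' \<otimes> T b"
    unfolding \<open>T b = T b'\<close> using assms(2,3) by (auto simp: rb_tilde_def)
  have kfix: "B (inv k) = inv k"
  proof -
    define d where "d = inv (B (inv b)) \<otimes> b \<otimes> B (inv b)"
    have d: "d \<in> carrier G" "B d = inv (B (inv b))"
      using assms B_inv[of "inv b"] by (auto simp: d_def)
    have e: "inv k = B (inv b') \<otimes> B d"
      unfolding d using assms B1 B2 by (simp add: k_def inv_mult_group m_assoc)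
    have "inv k = B (B (inv b') \<otimes> (d \<otimes> (inv (B (inv b')) \<otimes> inv b')))"
      using e B_mult'[of "inv b'" d] d assms by simp
    also have "B (inv b') \<otimes> (d \<otimes> (inv (B (inv b')) \<otimes> inv b')) = inv k"
      using B1 B2 assms by (simp add: d_def k_def inv_mult_group m_assoc)
    finally show ?thesis by simp
  qed
  have Tk: "T (Ad G (B a) k) = \<one>"
  proof -
    have "inv (Ad G (B a) k) = Ad G (B a) (inv k)"
      using assms by (simp add: Ad_def inv_mult_group m_assoc)
    then show ?thesis using fixed_Ad[of a "inv k"] kfix assms
      by (simp add: rb_tilde_def) (metis Ad_in B_in k r_inv)
  qed
  have "Ad G (B a) b' = Ad G \<one> (Ad G (B a) b) \<otimes> Ad G (B a) k"
    using assms by (simp add: b' Ad_def m_assoc)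
  then have "T (Ad G (B a) b') = T (Ad G (B a) k) \<otimes> T (Ad G (B a) b)"
    using t.B_mult[of "Ad G (B a) k" "Ad G (B a) b"] Tk assms by simp
  then show ?thesis using Tk assms by simp
qed

lemma B_Ad_cong:
  assumes "a \<in> carrier G" "b \<in> carrier G" "b' \<in> carrier G" "B b = B b'"
  shows "B (Ad G (T a) b) = B (Ad G (T a) b')"
  using rota_baxter_group.T_Ad_cong[OF T_rb, of a b b'] assms by (simp add: T_T)

lemma rb_rho_eq:
  assumes "a \<in> carrier G" "b \<in> carrier G"
  shows "rb_rho G B (B a) (T b) = T (Ad G (B a) b)"
  unfolding rb_rho_def
proof (rule the_equality)
  fix w assume "\<exists>a'\<in>carrier G. \<exists>b'\<in>carrier G. B a = B a' \<and> T b = T b' \<and> w = T (Ad G (B a') b')"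
  then obtain a' b' where *: "a' \<in> carrier G" "b' \<in> carrier G" "B a = B a'" "T b = T b'"
    "w = T (Ad G (B a) b')" by auto
  then show "w = T (Ad G (B a) b)" using T_Ad_cong[of a b' b] assms by simp
qed (use assms in auto)

lemma rb_mu_eq:
  assumes "a \<in> carrier G" "b \<in> carrier G"
  shows "rb_mu G B (T a) (B b) = B (Ad G (T a) b)"
  unfolding rb_mu_def
proof (rule the_equality)
  fix w assume "\<exists>a'\<in>carrier G. \<exists>b'\<in>carrier G. T a = T a' \<and> B b = B b' \<and> w = B (Ad G (T a') b')"
  then obtain a' b' where *: "a' \<in> carrier G" "b' \<in> carrier G" "T a = T a'" "B b = B b'"
    "w = B (Ad G (T a) b')" by auto
  then show "w = B (Ad G (T a) b)" using B_Ad_cong[of a b' b] assms by simp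
qed (use assms in auto)

lemma subgroup_T: "subgroup (T ` carrier G) G"
  by (rule rota_baxter_group.subgroup_B[OF T_rb])

lemmas plus_one = subgroup.one_closed[OF subgroup_B]
  and plus_mult = subgroup.m_closed[OF subgroup_B]
  and plus_inv = subgroup.m_inv_closed[OF subgroup_B]
  and minus_one = subgroup.one_closed[OF subgroup_T]
  and minus_mult = subgroup.m_closed[OF subgroup_T]
  and minus_inv = subgroup.m_inv_closed[OF subgroup_T]

lemma group_rb_plus: "group (rb_plus G B)"
  unfolding rb_plus_def by (rule subgroup_imp_group[OF subgroup_B])

lemma group_rb_minus: "group (rb_minus G B)"
  unfolding rb_minus_def by (rule subgroup_imp_group[OF subgroup_T])

lemma rb_rho_in: "\<lbrakk>u \<in> B ` carrier G; v \<in> T ` carrier G\<rbrakk> \<Longrightarrow> rb_rho G B u v \<in> T ` carrier G"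
  by (auto simp: rb_rho_eq)

lemma rb_mu_in: "\<lbrakk>v \<in> T ` carrier G; u \<in> B ` carrier G\<rbrakk> \<Longrightarrow> rb_mu G B v u \<in> B ` carrier G"
  by (auto simp: rb_mu_eq)

lemma Ad_mult: "\<lbrakk>a \<in> carrier G; b \<in> carrier G; c \<in> carrier G\<rbrakk> \<Longrightarrow> Ad G (a \<otimes> b) c = Ad G a (Ad G b c)"
  by (simp add: Ad_def m_assoc inv_mult_group)

lemma rb_rho_action:
  assumes "u \<in> B ` carrier G" "u' \<in> B ` carrier G" "v \<in> T ` carrier G"
  shows "rb_rho G B \<one> v = v"
    and "rb_rho G B (u \<otimes> u') v = rb_rho G B u (rb_rho G B u' v)"
proof -
  from assms obtain a a' b where ab: "a \<in> carrier G" "a' \<in> carrier G" "b \<in> carrier G"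
    "u = B a" "u' = B a'" "v = T b" by auto
  show "rb_rho G B \<one> v = v" using rb_rho_eq[of \<one> b] ab by (simp add: Ad_def)
  show "rb_rho G B (u \<otimes> u') v = rb_rho G B u (rb_rho G B u' v)"
    using ab by (simp add: B_mult rb_rho_eq flip: Ad_mult)
qed

lemma rb_mu_action:
  assumes "v \<in> T ` carrier G" "v' \<in> T ` carrier G" "u \<in> B ` carrier G"
  shows "rb_mu G B \<one> u = u"
    and "rb_mu G B (v \<otimes> v') u = rb_mu G B v (rb_mu G B v' u)"
proof -
  interpret t: rota_baxter_group G T by (rule T_rb)
  from assms obtain a a' b where ab: "a \<in> carrier G" "a' \<in> carrier G" "b \<in> carrier G"
    "v = T a" "v' = T a'" "u = B b" by auto
  show "rb_mu G B \<one> u = u" using rb_mu_eq[of \<one> b] ab by (simp add: Ad_def)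
  show "rb_mu G B (v \<otimes> v') u = rb_mu G B v (rb_mu G B v' u)"
    using ab by (simp add: t.B_mult rb_mu_eq flip: Ad_mult)
qed

lemma rb_factor:
  assumes "u \<in> B ` carrier G" "v \<in> T ` carrier G"
  shows "rb_rho G B u v \<otimes> inv (rb_mu G B (inv v) (inv u)) = u \<otimes> v"
proof -
  from assms obtain x y x' y' where ab: "x \<in> carrier G" "y \<in> carrier G" "u = B x" "v = T y"
    and ab': "x' \<in> carrier G" "y' \<in> carrier G" "inv u = B x'" "inv v = T y'"
    using subgroup.m_inv_closed[OF subgroup_B, of u] subgroup.m_inv_closed[OF subgroup_T, of v]
    by auto
  have uv: "u \<in> carrier G" "v \<in> carrier G" using ab by auto
  have "B (inv y) \<otimes> B (Ad G (inv v) x') = B (inv y \<otimes> x')"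
    using B_mult'[of "inv y" "Ad G (inv v) x'"] ab ab'(1) uv
    by (simp add: rb_tilde_def Ad_def inv_mult_group m_assoc)
  also have "\<dots> = B x' \<otimes> B (Ad G u (inv y))"
    using B_mult'[of x' "Ad G u (inv y)"] ab(1,2) ab'(1) uv unfolding ab'(3)[symmetric]
    by (simp add: Ad_def m_assoc)
  finally have e: "B (inv y) \<otimes> B (Ad G (inv v) x') = inv u \<otimes> B (Ad G u (inv y))"
    using ab' by simp
  have "u \<otimes> v \<otimes> B (Ad G (inv v) x') = u \<otimes> y \<otimes> (B (inv y) \<otimes> B (Ad G (inv v) x'))"
    using ab ab'(1) uv by (simp add: rb_tilde_def m_assoc)
  also have "\<dots> = Ad G u y \<otimes> B (Ad G u (inv y))"
    unfolding e using ab(1,2) uv by (simp add: Ad_def m_assoc)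
  also have "\<dots> = T (Ad G u y)"
    using ab(1,2) uv by (simp add: rb_tilde_def Ad_def m_assoc inv_mult_group)
  finally have eq: "T (Ad G u y) = u \<otimes> v \<otimes> B (Ad G (inv v) x')" by simp
  moreover have "rb_rho G B u v = T (Ad G u y)" using ab by (simp add: rb_rho_eq)
  moreover have "rb_mu G B (inv v) (inv u) = B (Ad G (inv v) x')"
    using ab' rb_mu_eq[of y' x'] by simp
  ultimately show ?thesis using uv ab'(1) by (simp add: eq m_assoc)
qed

lemma rb_rho_mult:
  assumes "u \<in> B ` carrier G" "v \<in> T ` carrier G" "v' \<in> T ` carrier G"
  shows "rb_rho G B u (v \<otimes> v') =
    rb_rho G B u v \<otimes> rb_rho G B (inv (rb_mu G B (inv v) (inv u))) v'"
proof -
  interpret t: rota_baxter_group G T by (rule T_rb)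
  define w where "w = inv (rb_mu G B (inv v) (inv u))"
  have "w \<in> B ` carrier G" unfolding w_def by (intro plus_inv rb_mu_in minus_inv assms)
  then obtain x y z c where ab: "x \<in> carrier G" "y \<in> carrier G" "z \<in> carrier G" "c \<in> carrier G"
    "u = B x" "v = T y" "v' = T z" "w = B c" using assms by (elim imageE) blast
  have f: "T (Ad G u y) \<otimes> w = u \<otimes> v"
    using rb_factor[OF assms(1,2), folded w_def] ab(1-7) by (simp add: rb_rho_eq)
  have "rb_rho G B u v \<otimes> rb_rho G B w v' = T (Ad G u y) \<otimes> T (Ad G w z)"
    using ab by (simp add: rb_rho_eq)
  also have "\<dots> = T (Ad G (T (Ad G u y)) (Ad G w z) \<otimes> Ad G u y)"
    using ab by (intro t.B_mult) auto
  also have "Ad G (T (Ad G u y)) (Ad G w z) = Ad G u (Ad G v z)"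
    using ab f by (simp flip: Ad_mult)
  also have "Ad G u (Ad G v z) \<otimes> Ad G u y = Ad G u (Ad G v z \<otimes> y)"
    using ab by (simp add: Ad_def m_assoc)
  also have "T \<dots> = rb_rho G B u (v \<otimes> v')"
    using ab by (simp add: t.B_mult rb_rho_eq)
  finally show ?thesis by (simp add: w_def)
qed

lemma rb_tilde_tilde:
  assumes "u \<in> B ` carrier G" "v \<in> T ` carrier G"
  shows "rb_rho G T v u = rb_mu G B v u" "rb_mu G T u v = rb_rho G B u v"
proof -
  interpret t: rota_baxter_group G T by (rule T_rb)
  from assms obtain x y where ab: "x \<in> carrier G" "y \<in> carrier G" "u = B x" "v = T y" by auto
  show "rb_rho G T v u = rb_mu G B v u" 
    using ab t.rb_rho_eq[of y x] by (simp add: T_T rb_mu_eq)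
  show "rb_mu G T u v = rb_rho G B u v"
    using ab t.rb_mu_eq[of x y] by (simp add: T_T rb_rho_eq)
qed

lemma rb_mu_mult:
  assumes "v \<in> T ` carrier G" "u \<in> B ` carrier G" "u' \<in> B ` carrier G"
  shows "rb_mu G B v (u \<otimes> u') =
    rb_mu G B v u \<otimes> rb_mu G B (inv (rb_rho G B (inv u) (inv v))) u'"
proof -
  interpret t: rota_baxter_group G T by (rule T_rb)
  have TT: "rb_tilde G T ` carrier G = B ` carrier G" by (auto simp: T_T image_iff)
  have "inv (rb_rho G B (inv u) (inv v)) \<in> T ` carrier G"
    by (intro plus_inv rb_rho_in minus_inv assms)
  then show ?thesis
    using t.rb_rho_mult[of v u u'] assms unfolding TT
    by (simp add: rb_tilde_tilde plus_mult plus_inv minus_inv del: image_iff)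
qed

theorem group_rb_bicrossed: "group (rb_bicrossed G B)"
proof -
  let ?\<rho> = "rb_rho G B" and ?\<mu> = "rb_mu G B"
  let ?P = "B ` carrier G" and ?M = "T ` carrier G"
  have car: "carrier (rb_bicrossed G B) = ?P \<times> ?M"
    by (simp add: bicrossed_def rb_plus_def rb_minus_def)
  have one: "\<one>\<^bsub>rb_bicrossed G B\<^esub> = (\<one>, \<one>)"
    by (simp add: bicrossed_def rb_plus_def rb_minus_def)
  have mult: "(a1, b1) \<otimes>\<^bsub>rb_bicrossed G B\<^esub> (a2, b2)
      = (inv (?\<mu> (inv b2) (inv a1)) \<otimes> a2, b1 \<otimes> ?\<rho> a1 b2)"
    if "a1 \<in> ?P" "b1 \<in> ?M" "b2 \<in> ?M" for a1 b1 a2 b2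
    using that
    by (simp add: bicrossed_def rb_plus_def rb_minus_def rb_mu_in plus_inv minus_inv
        m_inv_consistent[OF subgroup_B] m_inv_consistent[OF subgroup_T])
  have \<mu>1: "?\<mu> v \<one> = \<one>" if "v \<in> ?M" for v
    using that rb_mu_eq[of _ \<one>] by (auto simp: Ad_def)
  have cl: "\<And>x. x \<in> ?P \<Longrightarrow> x \<in> carrier G" "\<And>x. x \<in> ?M \<Longrightarrow> x \<in> carrier G" by auto
  show ?thesis
  proof (rule groupI, goal_cases)
    case (1 x y)
    then obtain a1 b1 a2 b2 where xy: "x = (a1, b1)" "y = (a2, b2)"
      and *: "a1 \<in> ?P" "a2 \<in> ?P" "b1 \<in> ?M" "b2 \<in> ?M"
      unfolding car by blast
    show ?case
      unfolding xy car mult[OF *(1,3,4)]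
      by (intro SigmaI rb_rho_in rb_mu_in plus_inv minus_inv plus_mult minus_mult *)
  next
    case 2
    show ?case unfolding car one by (intro SigmaI plus_one minus_one)
  next
    case (3 x y z)
    obtain a1 b1 a2 b2 a3 b3 where xyz: "x = (a1, b1)" "y = (a2, b2)" "z = (a3, b3)"
      by (cases x; cases y; cases z) auto
    with 3 have *: "a1 \<in> ?P" "a2 \<in> ?P" "a3 \<in> ?P" "b1 \<in> ?M" "b2 \<in> ?M" "b3 \<in> ?M"
      by (simp_all only: car mem_Times_iff fst_conv snd_conv)
    define r where "r = ?\<rho> a2 b3"
    define s where "s = ?\<mu> (inv b2) (inv a1)"
    have rs: "r \<in> ?M" "s \<in> ?P" unfolding r_def s_def by (intro rb_rho_in rb_mu_in plus_inv minus_inv *)+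
    have cr: "a1 \<in> carrier G" "a2 \<in> carrier G" "a3 \<in> carrier G" "b1 \<in> carrier G"
      "b2 \<in> carrier G" "b3 \<in> carrier G" "r \<in> carrier G" "s \<in> carrier G"
      using * rs cl by blast+
    have c: "?\<mu> (inv b3) (inv a2 \<otimes> s) = ?\<mu> (inv b3) (inv a2) \<otimes> ?\<mu> (inv r) s"
      using rb_mu_mult[OF minus_inv[OF *(6)] plus_inv[OF *(2)] rs(2)]
      unfolding inv_inv[OF cr(2)] inv_inv[OF cr(6)] r_def .
    have d: "?\<rho> a1 (b2 \<otimes> r) = ?\<rho> a1 b2 \<otimes> ?\<rho> (inv s) r"
      using rb_rho_mult[OF *(1,5) rs(1)] unfolding s_def .
    have s': "?\<mu> (inv r) s = ?\<mu> (inv (b2 \<otimes> r)) (inv a1)"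
      using rb_mu_action(2)[OF minus_inv[OF rs(1)] minus_inv[OF *(5)] plus_inv[OF *(1)]]
      unfolding inv_mult_group[OF cr(5,7)] s_def by (rule sym)
    have r': "?\<rho> (inv s \<otimes> a2) b3 = ?\<rho> (inv s) r"
      using rb_rho_action(2)[OF plus_inv[OF rs(2)] *(2,6)] unfolding r_def .
    have isa: "inv (inv s \<otimes> a2) = inv a2 \<otimes> s" using cr by (simp add: inv_mult_group)
    have mm: "?\<mu> (inv b3) (inv a2) \<in> ?P" "?\<mu> (inv (b2 \<otimes> r)) (inv a1) \<in> ?P"
      "?\<rho> a1 b2 \<in> ?M" "?\<rho> (inv s) r \<in> ?M" "inv s \<otimes> a2 \<in> ?P"
      "b1 \<otimes> ?\<rho> a1 b2 \<in> ?M" "b2 \<otimes> r \<in> ?M"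
      by (intro rb_rho_in rb_mu_in plus_inv minus_inv plus_mult minus_mult * rs)+
    have mc: "?\<mu> (inv b3) (inv a2) \<in> carrier G" "?\<mu> (inv (b2 \<otimes> r)) (inv a1) \<in> carrier G"
      "?\<rho> a1 b2 \<in> carrier G" "?\<rho> (inv s) r \<in> carrier G"
      using mm cl by blast+
    have "x \<otimes>\<^bsub>rb_bicrossed G B\<^esub> y \<otimes>\<^bsub>rb_bicrossed G B\<^esub> z =
        (inv (?\<mu> (inv b3) (inv a2 \<otimes> s)) \<otimes> a3, b1 \<otimes> ?\<rho> a1 b2 \<otimes> ?\<rho> (inv s) r)"
      unfolding xyz mult[OF *(1,4,5)] s_def[symmetric] mult[OF mm(5,6) *(6)] r' isa ..
    also have "\<dots> = (inv (?\<mu> (inv (b2 \<otimes> r)) (inv a1)) \<otimes> (inv (?\<mu> (inv b3) (inv a2)) \<otimes> a3),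
        b1 \<otimes> ?\<rho> a1 (b2 \<otimes> r))"
      unfolding c d s' using cr mc by (simp add: inv_mult_group m_assoc)
    also have "\<dots> = x \<otimes>\<^bsub>rb_bicrossed G B\<^esub> (y \<otimes>\<^bsub>rb_bicrossed G B\<^esub> z)"
      unfolding xyz mult[OF *(2,5,6)] r_def[symmetric] mult[OF *(1,4) mm(7)] ..
    finally show ?case .
  next
    case (4 x)
    then obtain a b where x: "x = (a, b)" and *: "a \<in> ?P" "b \<in> ?M"
      unfolding car by blast
    show ?case
      unfolding x one mult[OF plus_one minus_one *(2)]
      using cl(1)[OF *(1)] cl(2)[OF *(2)] by (simp add: \<mu>1[OF minus_inv[OF *(2)]] rb_rho_action(1)[OF *(1,1,2)])
  next
    case (5 x)
    then obtain a b where x: "x = (a, b)" and *: "a \<in> ?P" "b \<in> ?M"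
      unfolding car by blast
    define a1 where "a1 = inv (?\<mu> b a)"
    define b1 where "b1 = inv (?\<rho> a1 b)"
    have a1: "a1 \<in> ?P" unfolding a1_def by (intro plus_inv rb_mu_in *)
    have r: "?\<rho> a1 b \<in> ?M" by (intro rb_rho_in a1 *)
    then have b1: "b1 \<in> ?M" unfolding b1_def by (rule minus_inv)
    have "inv a1 = ?\<mu> b a"
      unfolding a1_def by (intro inv_inv cl(1) rb_mu_in *)
    moreover have "?\<mu> (inv b) (?\<mu> b a) = a"
      using rb_mu_action[OF minus_inv[OF *(2)] *(2,1)] cl(2)[OF *(2)] by simp
    ultimately have "(a1, b1) \<otimes>\<^bsub>rb_bicrossed G B\<^esub> x = \<one>\<^bsub>rb_bicrossed G B\<^esub>"
      unfolding x mult[OF a1 b1 *(2)] one unfolding b1_def using cl(1)[OF *(1)] cl(2)[OF r] by simp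
    with a1 b1 show ?case unfolding car by blast
  qed
qed

end

end

theory Submission
  imports Defs
begin

text \<open>
  Write \<open>T\<close> for the companion operator \<open>rb_tilde G B\<close> and read a pair \<open>(u, v)\<close> of the bicrossed
  product as the formal product \<open>v u\<close>.  The multiplication of the bicrossed product is made so that
  evaluating this formal product in \<open>G\<close> is a homomorphism \<open>\<pi>\<close> onto \<open>G\<close> (\<open>rb_eval_mult\<close>).  The
  factorisation \<open>x = T x \<otimes> inv (B (inv x))\<close> gives a section \<open>\<sigma> x = (inv (B (inv x)), T x)\<close> of \<open>\<pi>\<close>,
  and the Rota-Baxter identities of \<open>B\<close> and \<open>T\<close> make \<open>\<sigma>\<close> a homomorphism
  (\<open>rb_section_mult\<close>).  The operator \<open>C\<close> of the theorem is \<open>\<sigma> \<circ> \<pi>\<close>, hence an idempotent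
  homomorphism.

  The kernel of \<open>\<pi>\<close> consists of the pairs \<open>(inv w, w)\<close> with \<open>w\<close> in both images, and every such pair
  commutes with every \<open>\<sigma> x\<close> (\<open>rb_section_kernel\<close>, \<open>rb_kernel_section\<close>).  So the bicrossed product
  is the internal direct product of the image of \<open>\<sigma>\<close> and the kernel of \<open>\<pi>\<close>.  The complementary
  map \<open>z \<mapsto> z C(inv z)\<close> is the projection onto the second factor, and it remains to identify
  the kernel component of \<open>(B a, T b)\<close> with the formula for the second operator.  With
  \<open>e = Ad (B (inv b)) a \<otimes> inv b\<close>, so that \<open>B e = B (inv b) \<otimes> B a\<close>, this comes down to
  \<open>T (inv (B e)) = B (T (inv e))\<close> (\<open>T_inv_B\<close>).
\<close>

section \<open>Complements of idempotent endomorphisms\<close>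

context group
begin

text \<open>
  If \<open>C\<close> is an idempotent endomorphism whose image centralises its kernel, the group is the direct
  product of the two, and \<open>z \<mapsto> inv (C z) z\<close> is the projection onto the kernel.
\<close>

lemma idempotent_hom_complement:
  assumes C: "idempotent_hom G C"
    and comm: "\<And>y z. y \<in> carrier G \<Longrightarrow> z \<in> carrier G \<Longrightarrow>
      C y \<otimes> (inv (C z) \<otimes> z) = (inv (C z) \<otimes> z) \<otimes> C y"
  shows "idempotent_hom G (\<lambda>z. inv (C z) \<otimes> z)"
proof -
  have hom: "C \<in> hom G G" and idem: "\<And>z. z \<in> carrier G \<Longrightarrow> C (C z) = C z"
    using C by (auto simp: idempotent_hom_def)
  interpret C: group_hom G G C
    using hom by unfold_locales
  have mult: "inv (C (y \<otimes> z)) \<otimes> (y \<otimes> z) = (inv (C y) \<otimes> y) \<otimes> (inv (C z) \<otimes> z)"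
    if "y \<in> carrier G" "z \<in> carrier G" for y z
  proof -
    have "inv (C (y \<otimes> z)) \<otimes> (y \<otimes> z) = inv (C z) \<otimes> (inv (C y) \<otimes> y) \<otimes> z"
      using that by (simp add: inv_mult_group m_assoc)
    also have "inv (C z) \<otimes> (inv (C y) \<otimes> y) = (inv (C y) \<otimes> y) \<otimes> inv (C z)"
      using comm[of "inv z" y] that by simp
    finally show ?thesis using that by (simp add: m_assoc)
  qed
  show ?thesis
    unfolding idempotent_hom_def hom_def using mult idem by auto
qed

lemma idempotent_hom_cong:
  assumes "idempotent_hom G C" "\<And>z. z \<in> carrier G \<Longrightarrow> C' z = C z"
  shows "idempotent_hom G C'"
  using assms unfolding idempotent_hom_def hom_def by (auto simp: Pi_iff)

lemma complement_eq:
  assumes C: "idempotent_hom G C" and z: "z \<in> carrier G"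
    and comm: "C z \<otimes> (inv (C z) \<otimes> z) = (inv (C z) \<otimes> z) \<otimes> C z"
  shows "z \<otimes> C (inv z) = inv (C z) \<otimes> z"
proof -
  interpret C: group_hom G G C
    using C by unfold_locales (simp add: idempotent_hom_def)
  have "z = inv (C z) \<otimes> z \<otimes> C z" using comm z by simp
  then have "z \<otimes> inv (C z) = inv (C z) \<otimes> z"
    by (metis C.hom_closed inv_closed m_closed inv_solve_right' z)
  then show ?thesis using z by simp
qed

end

section \<open>The bicrossed product in terms of preimages\<close>

context rota_baxter_group
begin

abbreviation H where "H \<equiv> rb_bicrossed G B"

lemma carrier_H: "carrier H = B ` carrier G \<times> T ` carrier G"
  by (simp add: bicrossed_def rb_plus_def rb_minus_def)

lemma mult_H:
  assumes "u \<in> B ` carrier G" "v \<in> T ` carrier G" "v' \<in> T ` carrier G"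
  shows "(u, v) \<otimes>\<^bsub>H\<^esub> (u', v')
    = (inv (rb_mu G B (inv v') (inv u)) \<otimes> u', v \<otimes> rb_rho G B u v')"
  using assms
  by (simp add: bicrossed_def rb_plus_def rb_minus_def rb_mu_in plus_inv minus_inv
      m_inv_consistent[OF subgroup_B] m_inv_consistent[OF subgroup_T])

lemma rb_rho_Ad:
  "\<lbrakk>u \<in> B ` carrier G; c \<in> carrier G\<rbrakk> \<Longrightarrow> rb_rho G B u (T c) = T (Ad G u c)"
  by (auto simp: rb_rho_eq)

lemma rb_mu_Ad:
  "\<lbrakk>v \<in> T ` carrier G; c \<in> carrier G\<rbrakk> \<Longrightarrow> rb_mu G B v (B c) = B (Ad G v c)"
  by (auto simp: rb_mu_eq)

text \<open>
  Elements of the first factor are written as inverses \<open>inv (B p)\<close> because the multiplication applies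
  \<open>\<mu>\<close> to inverses: both components then become a single Rota-Baxter product.
\<close>

lemma mult_H_preimages:
  assumes [simp]: "p \<in> carrier G" "b \<in> carrier G" "q \<in> carrier G" "c \<in> carrier G"
  shows "(inv (B p), T b) \<otimes>\<^bsub>H\<^esub> (inv (B q), T c)
    = (inv (B (Ad G (B q \<otimes> inv (T c)) p \<otimes> q)), T (Ad G (T b \<otimes> inv (B p)) c \<otimes> b))"
proof -
  interpret t: rota_baxter_group G T by (rule T_rb)
  have in_images: "inv (B p) \<in> B ` carrier G" "inv (T c) \<in> T ` carrier G"
    by (intro plus_inv minus_inv imageI assms)+
  have "inv (B (Ad G (inv (T c)) p)) \<otimes> inv (B q) = inv (B q \<otimes> B (Ad G (inv (T c)) p))"
    by (simp add: inv_mult_group)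
  also have "B q \<otimes> B (Ad G (inv (T c)) p) = B (Ad G (B q \<otimes> inv (T c)) p \<otimes> q)"
    by (simp add: B_mult Ad_mult)
  finally have fst: "inv (B (Ad G (inv (T c)) p)) \<otimes> inv (B q)
    = inv (B (Ad G (B q \<otimes> inv (T c)) p \<otimes> q))" .
  have snd: "T b \<otimes> T (Ad G (inv (B p)) c) = T (Ad G (T b \<otimes> inv (B p)) c \<otimes> b)"
    by (simp add: t.B_mult Ad_mult)
  show ?thesis
    using in_images fst snd by (simp add: mult_H rb_rho_Ad rb_mu_Ad)
qed

section \<open>Evaluation in the group and its section\<close>

definition rb_eval :: "'a \<times> 'a \<Rightarrow> 'a" where
  "rb_eval z = snd z \<otimes> fst z"

definition rb_section :: "'a \<Rightarrow> 'a \<times> 'a" where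
  "rb_section x = (inv (B (inv x)), T x)"

lemma rb_eval_closed: "z \<in> carrier H \<Longrightarrow> rb_eval z \<in> carrier G"
  by (auto simp: carrier_H rb_eval_def)

lemma rb_section_closed: "x \<in> carrier G \<Longrightarrow> rb_section x \<in> carrier H"
  unfolding carrier_H rb_section_def by (intro SigmaI plus_inv imageI) auto

text \<open>
  Multiplying in the bicrossed product moves the inner factors of \<open>v u v' u'\<close> past each
  other by the refactorisation \<open>rb_factor\<close> of \<open>u v'\<close>.
\<close>

lemma rb_eval_mult:
  assumes "y \<in> carrier H" "z \<in> carrier H"
  shows "rb_eval (y \<otimes>\<^bsub>H\<^esub> z) = rb_eval y \<otimes> rb_eval z"
proof -
  obtain u v u' v' where yz: "y = (u, v)" "z = (u', v')" by (cases y; cases z)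
  with assms have in_images: "u \<in> B ` carrier G" "v \<in> T ` carrier G"
    "u' \<in> B ` carrier G" "v' \<in> T ` carrier G"
    by (simp_all only: carrier_H mem_Times_iff fst_conv snd_conv)
  define r where "r = rb_rho G B u v'"
  define s where "s = inv (rb_mu G B (inv v') (inv u))"
  have "r \<in> T ` carrier G" "s \<in> B ` carrier G"
    unfolding r_def s_def by (intro rb_rho_in plus_inv rb_mu_in minus_inv in_images)+
  then have [simp]: "r \<in> carrier G" "s \<in> carrier G" "u \<in> carrier G" "v \<in> carrier G"
    "u' \<in> carrier G" "v' \<in> carrier G"
    using in_images by auto
  have rs: "r \<otimes> s = u \<otimes> v'"
    unfolding r_def s_def by (rule rb_factor[OF in_images(1,4)])
  have "rb_eval (y \<otimes>\<^bsub>H\<^esub> z) = v \<otimes> r \<otimes> (s \<otimes> u')"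
    unfolding yz mult_H[OF in_images(1,2,4)] by (simp add: rb_eval_def r_def s_def)
  also have "\<dots> = v \<otimes> (r \<otimes> s) \<otimes> u'" by (simp add: m_assoc)
  finally show ?thesis
    unfolding rs by (simp add: yz rb_eval_def m_assoc)
qed

lemma T_mult_inv_B: "x \<in> carrier G \<Longrightarrow> T x \<otimes> inv (B (inv x)) = x"
  by (simp add: rb_tilde_def m_assoc)

lemma B_mult_inv_T: "x \<in> carrier G \<Longrightarrow> B (inv x) \<otimes> inv (T x) = inv x"
  by (simp add: rb_tilde_def inv_mult_group)

lemma rb_eval_section: "x \<in> carrier G \<Longrightarrow> rb_eval (rb_section x) = x"
  by (simp add: rb_eval_def rb_section_def T_mult_inv_B)

text \<open>
  For the preimages \<open>inv x\<close>, \<open>x\<close> and \<open>inv y\<close>, \<open>y\<close> the conjugators in \<open>mult_H_preimages\<close> collapse to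
  \<open>inv y\<close> and \<open>x\<close>, which turns both components into products in \<open>G\<close>.
\<close>

lemma rb_section_mult:
  assumes "x \<in> carrier G" "y \<in> carrier G"
  shows "rb_section (x \<otimes> y) = rb_section x \<otimes>\<^bsub>H\<^esub> rb_section y"
  using assms mult_H_preimages[of "inv x" x "inv y" y]
  by (simp add: rb_section_def T_mult_inv_B B_mult_inv_T Ad_def inv_mult_group m_assoc)

section \<open>The kernel of the evaluation\<close>

text \<open>
  The next two lemmas have the same right-hand side: elements \<open>(inv w, w)\<close> of the kernel, where
  \<open>w = B d = T c\<close>, commute with the section.
\<close>

lemma rb_section_kernel:
  assumes "x \<in> carrier G" "c \<in> carrier G" "d \<in> carrier G" "B d = T c"
  shows "rb_section x \<otimes>\<^bsub>H\<^esub> (inv (B d), T c) = (inv (B (inv x \<otimes> d)), T (x \<otimes> c))"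
  using assms mult_H_preimages[of "inv x" x d c]
  by (simp add: rb_section_def T_mult_inv_B Ad_def m_assoc)

lemma rb_kernel_section:
  assumes "x \<in> carrier G" "c \<in> carrier G" "d \<in> carrier G" "B d = T c"
  shows "(inv (B d), T c) \<otimes>\<^bsub>H\<^esub> rb_section x = (inv (B (inv x \<otimes> d)), T (x \<otimes> c))"
  using assms mult_H_preimages[of d c "inv x" x]
  by (simp add: rb_section_def B_mult_inv_T Ad_def m_assoc)

text \<open>This is the Rota-Baxter identity for the product of \<open>B e\<close> and \<open>B (T (inv e))\<close>.\<close>

lemma T_inv_B:
  assumes "e \<in> carrier G"
  shows "T (inv (B e)) = B (T (inv e))"
proof -
  have "B e \<otimes> B (T (inv e)) = B (B e)"
    using B_mult'[of e "T (inv e)"] assms by (simp add: rb_tilde_def m_assoc)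
  then have "B (T (inv e)) = inv (B e) \<otimes> B (B e)"
    using assms by (metis B_in T_in inv_cancel_left(1) inv_closed)
  then show ?thesis using assms by (simp add: rb_tilde_def)
qed

text \<open>
  Both sides come from one element \<open>e\<close>: the left argument is \<open>T (inv e)\<close> and the right argument is
  \<open>inv (B e)\<close>.  It is the product of \<open>inv b\<close> and \<open>a\<close> in the descendent group, the group structure on
  \<open>G\<close> that makes \<open>B\<close> a homomorphism.
\<close>

lemma kernel_component_inverse:
  assumes "a \<in> carrier G" "b \<in> carrier G"
  shows "B (T b \<otimes> T (inv a)) = T (inv (B a) \<otimes> inv (B (inv b)))"
proof -
  define e where "e = Ad G (B (inv b)) a \<otimes> inv b"
  have e: "e \<in> carrier G" "B e = B (inv b) \<otimes> B a"
    using assms B_mult[of "inv b" a] by (simp_all add: e_def)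
  have "inv e \<otimes> B e = T b \<otimes> T (inv a)"
    unfolding e(2) using assms by (simp add: e_def Ad_def rb_tilde_def inv_mult_group m_assoc)
  then have "T (inv e) = T b \<otimes> T (inv a)"
    using e(1) by (simp add: rb_tilde_def)
  then show ?thesis
    using T_inv_B[OF e(1)] assms by (simp add: e(2) inv_mult_group)
qed

definition rb_kernel_component :: "'a \<Rightarrow> 'a \<Rightarrow> 'a \<times> 'a" where
  "rb_kernel_component a b =
    (inv (B (T b \<otimes> T (inv a))), T (inv (B a) \<otimes> inv (B (inv b))))"

lemma rb_kernel_component_closed:
  assumes "a \<in> carrier G" "b \<in> carrier G"
  shows "rb_kernel_component a b \<in> carrier H"
  unfolding carrier_H rb_kernel_component_def
  by (intro SigmaI plus_inv imageI) (use assms in auto)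

lemma rb_kernel_component_commute:
  assumes "a \<in> carrier G" "b \<in> carrier G" "x \<in> carrier G"
  shows "rb_section x \<otimes>\<^bsub>H\<^esub> rb_kernel_component a b = rb_kernel_component a b \<otimes>\<^bsub>H\<^esub> rb_section x"
  using rb_section_kernel[OF _ _ _ kernel_component_inverse[OF assms(1,2)], of x]
    rb_kernel_section[OF _ _ _ kernel_component_inverse[OF assms(1,2)], of x] assms
  by (simp add: rb_kernel_component_def)

lemma rb_section_kernel_decomposition:
  assumes "a \<in> carrier G" "b \<in> carrier G"
  shows "rb_section (rb_eval (B a, T b)) \<otimes>\<^bsub>H\<^esub> rb_kernel_component a b = (B a, T b)"
proof -
  let ?x = "T b \<otimes> B a"
  let ?c = "inv (B a) \<otimes> inv (B (inv b))"
  let ?d = "T b \<otimes> T (inv a)"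
  have "?x \<otimes> ?c = b"
    using assms by (simp add: m_assoc T_mult_inv_B)
  moreover have "inv ?x \<otimes> ?d = inv (B a) \<otimes> inv a \<otimes> B a"
    using assms by (simp add: inv_mult_group m_assoc) (simp add: rb_tilde_def)
  then have "inv (B (inv ?x \<otimes> ?d)) = B a"
    using assms B_inv[of a] by (metis B_in inv_inv)
  ultimately show ?thesis
    using rb_section_kernel[OF _ _ _ kernel_component_inverse[OF assms], of ?x] assms
    by (simp add: rb_kernel_component_def rb_eval_def)
qed

section \<open>The two projections\<close>

definition rb_proj :: "'a \<times> 'a \<Rightarrow> 'a \<times> 'a" where
  "rb_proj z = rb_section (rb_eval z)"

definition rb_coproj :: "'a \<times> 'a \<Rightarrow> 'a \<times> 'a" where
  "rb_coproj z = inv\<^bsub>H\<^esub> (rb_proj z) \<otimes>\<^bsub>H\<^esub> z"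

lemma rb_proj_closed: "z \<in> carrier H \<Longrightarrow> rb_proj z \<in> carrier H"
  by (simp only: rb_proj_def rb_section_closed rb_eval_closed)

lemma rb_proj_eq:
  assumes "a \<in> carrier G" "b \<in> carrier G"
  shows "rb_proj (B a, T b) = (inv (B (inv (B a) \<otimes> inv (T b))), T (T b \<otimes> B a))"
  using assms by (simp add: rb_proj_def rb_section_def rb_eval_def inv_mult_group)

lemma idempotent_hom_rb_proj: "idempotent_hom H rb_proj"
  unfolding idempotent_hom_def
proof (intro conjI ballI homI)
  fix y z assume "y \<in> carrier H" "z \<in> carrier H"
  then show "rb_proj (y \<otimes>\<^bsub>H\<^esub> z) = rb_proj y \<otimes>\<^bsub>H\<^esub> rb_proj z"
    by (simp only: rb_proj_def rb_eval_mult rb_section_mult rb_eval_closed)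
next
  fix z assume "z \<in> carrier H"
  then show "rb_proj (rb_proj z) = rb_proj z"
    by (simp only: rb_proj_def rb_eval_section rb_eval_closed)
qed (rule rb_proj_closed)

lemma pair_closed: "\<lbrakk>a \<in> carrier G; b \<in> carrier G\<rbrakk> \<Longrightarrow> (B a, T b) \<in> carrier H"
  unfolding carrier_H by (intro SigmaI imageI)

text \<open>
  That the value depends only on the pair, and not on the preimages \<open>a\<close> and \<open>b\<close>, comes for free: the
  kernel component is determined by the decomposition.
\<close>

lemma rb_coproj_eq:
  assumes "a \<in> carrier G" "b \<in> carrier G"
  shows "rb_coproj (B a, T b) = rb_kernel_component a b"
proof -
  interpret H: group H by (rule group_rb_bicrossed)
  have "rb_proj (B a, T b) \<otimes>\<^bsub>H\<^esub> rb_kernel_component a b = (B a, T b)"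
    using rb_section_kernel_decomposition[OF assms] by (simp only: rb_proj_def)
  then show ?thesis
    unfolding rb_coproj_def
    using H.inv_cancel_left(1)[OF rb_proj_closed[OF pair_closed[OF assms]]
        rb_kernel_component_closed[OF assms]]
    by (simp only:)
qed

lemma rb_proj_coproj:
  assumes "z \<in> carrier H"
  shows "rb_proj z \<otimes>\<^bsub>H\<^esub> rb_coproj z = z"
proof -
  interpret H: group H by (rule group_rb_bicrossed)
  show ?thesis
    unfolding rb_coproj_def by (rule H.inv_cancel_left(2)[OF rb_proj_closed[OF assms] assms])
qed

lemma rb_proj_coproj_commute:
  assumes "y \<in> carrier H" "z \<in> carrier H"
  shows "rb_proj y \<otimes>\<^bsub>H\<^esub> rb_coproj z = rb_coproj z \<otimes>\<^bsub>H\<^esub> rb_proj y"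
proof -
  from assms(2) obtain a b where ab: "a \<in> carrier G" "b \<in> carrier G" "z = (B a, T b)"
    unfolding carrier_H by blast
  show ?thesis
    unfolding ab(3) rb_coproj_eq[OF ab(1,2)] rb_proj_def
    by (rule rb_kernel_component_commute[OF ab(1,2) rb_eval_closed[OF assms(1)]])
qed

lemma idempotent_hom_rb_coproj: "idempotent_hom H rb_coproj"
proof -
  interpret H: group H by (rule group_rb_bicrossed)
  show ?thesis
    using H.idempotent_hom_complement[OF idempotent_hom_rb_proj
        rb_proj_coproj_commute[unfolded rb_coproj_def]]
    unfolding rb_coproj_def[abs_def] .
qed

lemma group_projection_rb_proj:
  "group_projection (rb_plus G B) (rb_minus G B) (rb_rho G B) (rb_mu G B) rb_proj"
proof -
  interpret H: group H by (rule group_rb_bicrossed)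
  have "idempotent_hom H (\<lambda>z. z \<otimes>\<^bsub>H\<^esub> rb_proj (inv\<^bsub>H\<^esub> z))"
    by (rule H.idempotent_hom_cong[OF idempotent_hom_rb_coproj])
      (unfold rb_coproj_def, rule H.complement_eq[OF idempotent_hom_rb_proj],
        auto intro: rb_proj_coproj_commute[unfolded rb_coproj_def])
  then show ?thesis
    unfolding group_projection_def Let_def using idempotent_hom_rb_proj by blast
qed

text \<open>
  The complement of \<open>rb_coproj\<close> sends \<open>z\<close> to \<open>z rb_proj z (inv z)\<close>, which is \<open>rb_proj z\<close> again because
  \<open>rb_proj z\<close> commutes with both factors of \<open>z\<close>.
\<close>

lemma group_projection_rb_coproj:
  "group_projection (rb_plus G B) (rb_minus G B) (rb_rho G B) (rb_mu G B) rb_coproj"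
proof -
  interpret H: group H by (rule group_rb_bicrossed)
  interpret proj: group_hom H H rb_proj
    using idempotent_hom_rb_proj by unfold_locales (simp add: idempotent_hom_def)
  have "z \<otimes>\<^bsub>H\<^esub> rb_coproj (inv\<^bsub>H\<^esub> z) = rb_proj z" if z: "z \<in> carrier H" for z
  proof -
    have "z \<otimes>\<^bsub>H\<^esub> rb_proj z = rb_proj z \<otimes>\<^bsub>H\<^esub> z"
      using rb_proj_coproj_commute[OF z z] rb_proj_coproj[OF z] z
      by (metis H.m_assoc H.inv_closed H.m_closed rb_proj_closed rb_coproj_def)
    then show ?thesis
      unfolding rb_coproj_def proj.hom_inv[OF z] H.inv_inv[OF rb_proj_closed[OF z]]
      by (metis H.inv_closed H.inv_solve_right' H.m_assoc H.m_closed rb_proj_closed z)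
  qed
  then have "idempotent_hom H (\<lambda>z. z \<otimes>\<^bsub>H\<^esub> rb_coproj (inv\<^bsub>H\<^esub> z))"
    by (rule H.idempotent_hom_cong[OF idempotent_hom_rb_proj])
  then show ?thesis
    unfolding group_projection_def Let_def using idempotent_hom_rb_coproj by blast
qed

end

theorem theorem4p21:
  fixes G :: "('a, 'm) monoid_scheme" (structure) and B :: "'a \<Rightarrow> 'a"
  assumes "rota_baxter_group G B"
  shows "\<exists>C Ct.
      (\<forall>a\<in>carrier G. \<forall>b\<in>carrier G.
        C (B a, rb_tilde G B b) =
          (inv (B (inv (B a) \<otimes> inv (rb_tilde G B b))),
           rb_tilde G B (rb_tilde G B b \<otimes> B a)))
    \<and> (\<forall>a\<in>carrier G. \<forall>b\<in>carrier G.
        Ct (B a, rb_tilde G B b) =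
          (inv (B (rb_tilde G B b \<otimes> rb_tilde G B (inv a))),
           rb_tilde G B (inv (B a) \<otimes> inv (B (inv b)))))
    \<and> group_projection (rb_plus G B) (rb_minus G B) (rb_rho G B) (rb_mu G B) C
    \<and> group_projection (rb_plus G B) (rb_minus G B) (rb_rho G B) (rb_mu G B) Ct
    \<and> (\<forall>a\<in>carrier G. \<forall>b\<in>carrier G.
        C (B a, rb_tilde G B b) \<otimes>\<^bsub>rb_bicrossed G B\<^esub> Ct (B a, rb_tilde G B b)
          = (B a, rb_tilde G B b))"
proof -
  interpret rota_baxter_group G B by (rule assms)
  show ?thesis
  proof (rule exI[of _ rb_proj], rule exI[of _ rb_coproj], intro conjI ballI)
    fix a b assume ab: "a \<in> carrier G" "b \<in> carrier G"
    show "rb_proj (B a, T b) = (inv (B (inv (B a) \<otimes> inv (T b))), T (T b \<otimes> B a))"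
      by (rule rb_proj_eq[OF ab])
    show "rb_coproj (B a, T b)
      = (inv (B (T b \<otimes> T (inv a))), T (inv (B a) \<otimes> inv (B (inv b))))"
      unfolding rb_coproj_eq[OF ab] rb_kernel_component_def ..
    show "rb_proj (B a, T b) \<otimes>\<^bsub>H\<^esub> rb_coproj (B a, T b) = (B a, T b)"
      by (rule rb_proj_coproj[OF pair_closed[OF ab]])
  qed (rule group_projection_rb_proj group_projection_rb_coproj)+
qed

end
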